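(* Let $\mathbf{Hilb}_m$ be the category whose objects are complex Hilbert spaces and whose morphisms are injective linear contractions. Then $\mathbf{Hilb}_m$ is not an abstract elementary category.
   Context: A linear map $f:A\to B$ of Hilbert spaces is a contraction if $\|f(a)\|\le\|a\|$ for every $a\in A$. A category $\mathcal{K}$ is an abstract elementary category if: (1) $\mathcal{K}$ is accessible and has all directed colimits; and (2) there is an embedding of categories $F:\mathcal{K}\to\mathcal{L}$ (a faithful functor, injective on objects), with $\mathcal{L}$ a finitely accessible category, such that: (a) $F$ is iso-full: every isomorphism $f:FA\to FB$ in $\mathcal{L}$ is of the form $F(\bar f)$ for some $\bar f:A\to B$ in $\mathcal{K}$; (b) $F$ is coherent: whenever $h:A\to C$ and $g:B\to C$ are morphisms of $\mathcal{K}$ and $f:FA\to FB$ is a morphism of $\mathcal{L}$ with $F(g)\circ f=F(h)$, there is $\bar f:A\to B$ in $\mathcal{K}$ with $F(\bar f)=f$; (c) $F$ preserves directed colimits. *)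

theory Defs
  imports "HOL-Analysis.Analysis"
begin

unbundle cardinal_syntax

text \<open>
  A type \<open>'u\<close> plays the role of the universe: a set, of whatever type, is \<^emph>\<open>small\<close> if it has fewer
  elements than \<open>'u\<close>. If \<open>'u\<close> has (uncountable) strongly inaccessible cardinality, the small sets
  are those of a Grothendieck universe. Hom-sets, index posets of diagrams and the underlying sets
  of Hilbert spaces have to be small. As every small set has a copy inside \<open>'u\<close>, index posets and
  Hilbert spaces may be taken to live on subsets of \<open>'u\<close>.
\<close>

definition small :: "'u itself \<Rightarrow> 'a set \<Rightarrow> bool" where
  "small U X \<longleftrightarrow> |X| <o |UNIV :: 'u set|"


section \<open>Categories and functors\<close>

record ('o, 'm) cat =
  Obj :: "'o set"
  Arr :: "'m set"
  Dom :: "'m \<Rightarrow> 'o"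
  Cod :: "'m \<Rightarrow> 'o"
  Ide :: "'o \<Rightarrow> 'm"
  Cmp :: "'m \<Rightarrow> 'm \<Rightarrow> 'm"  (infixr "\<cdot>\<index>" 70)

definition hom :: "('o, 'm) cat \<Rightarrow> 'o \<Rightarrow> 'o \<Rightarrow> 'm set" where
  "hom C A B = {f \<in> Arr C. Dom C f = A \<and> Cod C f = B}"

locale category =
  fixes C :: "('o, 'm) cat" (structure)
  assumes Dom_Obj: "f \<in> Arr C \<Longrightarrow> Dom C f \<in> Obj C"
    and Cod_Obj: "f \<in> Arr C \<Longrightarrow> Cod C f \<in> Obj C"
    and Ide_hom: "A \<in> Obj C \<Longrightarrow> Ide C A \<in> hom C A A"
    and Cmp_hom: "f \<in> hom C A B \<Longrightarrow> g \<in> hom C B E \<Longrightarrow> g \<cdot> f \<in> hom C A E"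
    and Cmp_Ide: "f \<in> hom C A B \<Longrightarrow> f \<cdot> Ide C A = f"
    and Ide_Cmp: "f \<in> hom C A B \<Longrightarrow> Ide C B \<cdot> f = f"
    and Cmp_assoc: "f \<in> hom C A B \<Longrightarrow> g \<in> hom C B E \<Longrightarrow> h \<in> hom C E G
      \<Longrightarrow> (h \<cdot> g) \<cdot> f = h \<cdot> (g \<cdot> f)"

definition isomorphism :: "('o, 'm) cat \<Rightarrow> 'o \<Rightarrow> 'o \<Rightarrow> 'm \<Rightarrow> bool" where
  "isomorphism C A B f \<longleftrightarrow> f \<in> hom C A B \<and>
     (\<exists>g \<in> hom C B A. g \<cdot>\<^bsub>C\<^esub> f = Ide C A \<and> f \<cdot>\<^bsub>C\<^esub> g = Ide C B)"

definition locally_small :: "'u itself \<Rightarrow> ('o, 'm) cat \<Rightarrow> bool" where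
  "locally_small U C \<longleftrightarrow> (\<forall>A \<in> Obj C. \<forall>B \<in> Obj C. small U (hom C A B))"

text \<open>A functor is given by its object part \<open>Fo\<close> and its arrow part \<open>Fm\<close>.\<close>

definition is_functor ::
    "('o, 'm) cat \<Rightarrow> ('p, 'n) cat \<Rightarrow> ('o \<Rightarrow> 'p) \<Rightarrow> ('m \<Rightarrow> 'n) \<Rightarrow> bool" where
  "is_functor C D Fo Fm \<longleftrightarrow>
     (\<forall>A \<in> Obj C. Fo A \<in> Obj D) \<and>
     (\<forall>A \<in> Obj C. \<forall>B \<in> Obj C. \<forall>f \<in> hom C A B. Fm f \<in> hom D (Fo A) (Fo B)) \<and>
     (\<forall>A \<in> Obj C. Fm (Ide C A) = Ide D (Fo A)) \<and>
     (\<forall>A \<in> Obj C. \<forall>B \<in> Obj C. \<forall>E \<in> Obj C. \<forall>f \<in> hom C A B. \<forall>g \<in> hom C B E.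
        Fm (g \<cdot>\<^bsub>C\<^esub> f) = Fm g \<cdot>\<^bsub>D\<^esub> Fm f)"

definition embedding ::
    "('o, 'm) cat \<Rightarrow> ('p, 'n) cat \<Rightarrow> ('o \<Rightarrow> 'p) \<Rightarrow> ('m \<Rightarrow> 'n) \<Rightarrow> bool" where
  "embedding C D Fo Fm \<longleftrightarrow> is_functor C D Fo Fm \<and>
     (\<forall>A \<in> Obj C. \<forall>B \<in> Obj C. inj_on Fm (hom C A B)) \<and> inj_on Fo (Obj C)"

definition iso_full ::
    "('o, 'm) cat \<Rightarrow> ('p, 'n) cat \<Rightarrow> ('o \<Rightarrow> 'p) \<Rightarrow> ('m \<Rightarrow> 'n) \<Rightarrow> bool" where
  "iso_full C D Fo Fm \<longleftrightarrow>
     (\<forall>A \<in> Obj C. \<forall>B \<in> Obj C. \<forall>f. isomorphism D (Fo A) (Fo B) f \<longrightarrow>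
        (\<exists>f' \<in> hom C A B. Fm f' = f))"

definition coherent ::
    "('o, 'm) cat \<Rightarrow> ('p, 'n) cat \<Rightarrow> ('o \<Rightarrow> 'p) \<Rightarrow> ('m \<Rightarrow> 'n) \<Rightarrow> bool" where
  "coherent C D Fo Fm \<longleftrightarrow>
     (\<forall>A \<in> Obj C. \<forall>B \<in> Obj C. \<forall>E \<in> Obj C.
      \<forall>h \<in> hom C A E. \<forall>g \<in> hom C B E. \<forall>f \<in> hom D (Fo A) (Fo B).
        Fm g \<cdot>\<^bsub>D\<^esub> f = Fm h \<longrightarrow> (\<exists>f' \<in> hom C A B. Fm f' = f))"


section \<open>Directed colimits\<close>

text \<open>For \<open>\<kappa> = natLeq\<close> the sets of cardinality below \<open>\<kappa>\<close> are the finite ones, so that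
  \<open>directed_poset natLeq\<close> is directedness in the usual sense (of a nonempty poset).\<close>

definition directed_poset :: "'k rel \<Rightarrow> 'i set \<Rightarrow> 'i rel \<Rightarrow> bool" where
  "directed_poset \<kappa> I r \<longleftrightarrow> partial_order_on I r \<and>
     (\<forall>X \<subseteq> I. |X| <o \<kappa> \<longrightarrow> (\<exists>u \<in> I. \<forall>x \<in> X. (x, u) \<in> r))"

definition diagram ::
    "('o, 'm) cat \<Rightarrow> 'i set \<Rightarrow> 'i rel \<Rightarrow> ('i \<Rightarrow> 'o) \<Rightarrow> ('i \<Rightarrow> 'i \<Rightarrow> 'm) \<Rightarrow> bool" where
  "diagram C I r Do Dm \<longleftrightarrow>
     (\<forall>i \<in> I. Do i \<in> Obj C) \<and>
     (\<forall>i j. (i, j) \<in> r \<longrightarrow> Dm i j \<in> hom C (Do i) (Do j)) \<and>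
     (\<forall>i \<in> I. Dm i i = Ide C (Do i)) \<and>
     (\<forall>i j k. (i, j) \<in> r \<longrightarrow> (j, k) \<in> r \<longrightarrow> Dm j k \<cdot>\<^bsub>C\<^esub> Dm i j = Dm i k)"

definition cocone :: "('o, 'm) cat \<Rightarrow> 'i set \<Rightarrow> 'i rel \<Rightarrow> ('i \<Rightarrow> 'o) \<Rightarrow> ('i \<Rightarrow> 'i \<Rightarrow> 'm)
    \<Rightarrow> 'o \<Rightarrow> ('i \<Rightarrow> 'm) \<Rightarrow> bool" where
  "cocone C I r Do Dm X c \<longleftrightarrow> X \<in> Obj C \<and>
     (\<forall>i \<in> I. c i \<in> hom C (Do i) X) \<and>
     (\<forall>i j. (i, j) \<in> r \<longrightarrow> c j \<cdot>\<^bsub>C\<^esub> Dm i j = c i)"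

definition colimit :: "('o, 'm) cat \<Rightarrow> 'i set \<Rightarrow> 'i rel \<Rightarrow> ('i \<Rightarrow> 'o) \<Rightarrow> ('i \<Rightarrow> 'i \<Rightarrow> 'm)
    \<Rightarrow> 'o \<Rightarrow> ('i \<Rightarrow> 'm) \<Rightarrow> bool" where
  "colimit C I r Do Dm X c \<longleftrightarrow> cocone C I r Do Dm X c \<and>
     (\<forall>Y d. cocone C I r Do Dm Y d \<longrightarrow>
        (\<exists>!u. u \<in> hom C X Y \<and> (\<forall>i \<in> I. u \<cdot>\<^bsub>C\<^esub> c i = d i)))"

definition has_directed_colimits :: "'u itself \<Rightarrow> 'k rel \<Rightarrow> ('o, 'm) cat \<Rightarrow> bool" where
  "has_directed_colimits U \<kappa> C \<longleftrightarrow>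
     (\<forall>(I :: 'u set) r Do Dm. small U I \<and> directed_poset \<kappa> I r \<and> diagram C I r Do Dm \<longrightarrow>
        (\<exists>X c. colimit C I r Do Dm X c))"

definition preserves_directed_colimits :: "'u itself \<Rightarrow> 'k rel
    \<Rightarrow> ('o, 'm) cat \<Rightarrow> ('p, 'n) cat \<Rightarrow> ('o \<Rightarrow> 'p) \<Rightarrow> ('m \<Rightarrow> 'n) \<Rightarrow> bool" where
  "preserves_directed_colimits U \<kappa> C D Fo Fm \<longleftrightarrow>
     (\<forall>(I :: 'u set) r Do Dm X c.
        small U I \<and> directed_poset \<kappa> I r \<and> diagram C I r Do Dm \<and> colimit C I r Do Dm X c \<longrightarrow>
        colimit D I r (\<lambda>i. Fo (Do i)) (\<lambda>i j. Fm (Dm i j)) (Fo X) (\<lambda>i. Fm (c i)))"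


section \<open>Accessible categories\<close>

text \<open>The category of small sets of elements of \<open>'a\<close>. An arrow is a triple of domain, function and
  codomain, the function being \<^const>\<open>undefined\<close> outside the domain.\<close>

definition Sets :: "'u itself \<Rightarrow> ('a set, 'a set \<times> ('a \<Rightarrow> 'a) \<times> 'a set) cat" where
  "Sets U = \<lparr> Obj = {X. small U X},
     Arr = {(X, f, Y). small U X \<and> small U Y \<and> f \<in> X \<rightarrow>\<^sub>E Y},
     Dom = (\<lambda>(X, f, Y). X),
     Cod = (\<lambda>(X, f, Y). Y),
     Ide = (\<lambda>X. (X, \<lambda>x\<in>X. x, X)),
     Cmp = (\<lambda>(Y, g, Z) (X, f, Y'). (X, compose X g f, Z)) \<rparr>"

text \<open>The covariant functor represented by \<open>A\<close>, on arrows. Its values are sets of arrows of \<open>C\<close>.\<close>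

definition hom_map :: "('o, 'm) cat \<Rightarrow> 'o \<Rightarrow> 'm \<Rightarrow> 'm set \<times> ('m \<Rightarrow> 'm) \<times> 'm set" where
  "hom_map C A u = (hom C A (Dom C u), \<lambda>f\<in>hom C A (Dom C u). u \<cdot>\<^bsub>C\<^esub> f, hom C A (Cod C u))"

definition presentable :: "'u itself \<Rightarrow> 'k rel \<Rightarrow> ('o, 'm) cat \<Rightarrow> 'o \<Rightarrow> bool" where
  "presentable U \<kappa> C A \<longleftrightarrow> A \<in> Obj C \<and>
     preserves_directed_colimits U \<kappa> C (Sets U) (hom C A) (hom_map C A)"

text \<open>\<open>\<kappa>\<close> is meant to be an infinite regular cardinal.\<close>

definition accessible_at :: "'u itself \<Rightarrow> 'k rel \<Rightarrow> ('o, 'm) cat \<Rightarrow> bool" where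
  "accessible_at U \<kappa> C \<longleftrightarrow> category C \<and> locally_small U C \<and> has_directed_colimits U \<kappa> C \<and>
     (\<exists>P. small U P \<and> (\<forall>A \<in> P. presentable U \<kappa> C A) \<and>
        (\<forall>X \<in> Obj C. \<exists>(I :: 'u set) r Do Dm c.
           small U I \<and> directed_poset \<kappa> I r \<and> diagram C I r Do Dm \<and> (\<forall>i \<in> I. Do i \<in> P) \<and>
           colimit C I r Do Dm X c))"

definition finitely_accessible :: "'u itself \<Rightarrow> ('o, 'm) cat \<Rightarrow> bool" where
  "finitely_accessible U C \<longleftrightarrow> accessible_at U natLeq C"

definition accessible :: "'u itself \<Rightarrow> ('o, 'm) cat \<Rightarrow> bool" where
  "accessible U C \<longleftrightarrow>
     (\<exists>\<kappa> :: 'u rel. Cinfinite \<kappa> \<and> regularCard \<kappa> \<and> small U (Field \<kappa>) \<and> accessible_at U \<kappa> C)"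


section \<open>Abstract elementary categories\<close>

text \<open>HOL cannot quantify over the types of objects and arrows of the ambient category \<open>L\<close>, so
  these are parameters. Not being an abstract elementary category means that the predicate fails
  for all choices of \<open>'p\<close> and \<open>'n\<close>.\<close>

definition abstract_elementary_category ::
    "'u itself \<Rightarrow> 'p itself \<Rightarrow> 'n itself \<Rightarrow> ('o, 'm) cat \<Rightarrow> bool" where
  "abstract_elementary_category U P N K \<longleftrightarrow>
     accessible U K \<and> has_directed_colimits U natLeq K \<and>
     (\<exists>(L :: ('p, 'n) cat) Fo Fm. finitely_accessible U L \<and> embedding K L Fo Fm \<and>
        iso_full K L Fo Fm \<and> coherent K L Fo Fm \<and>
        preserves_directed_colimits U natLeq K L Fo Fm)"


section \<open>Hilbert spaces\<close>

record 'u hilbert =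
  carrier :: "'u set"
  add :: "'u \<Rightarrow> 'u \<Rightarrow> 'u"  (infixl "\<oplus>\<index>" 65)
  zero :: 'u  ("\<zero>\<index>")
  scale :: "complex \<Rightarrow> 'u \<Rightarrow> 'u"  (infixr "\<odot>\<index>" 70)
  iprod :: "'u \<Rightarrow> 'u \<Rightarrow> complex"

definition hnorm :: "'u hilbert \<Rightarrow> 'u \<Rightarrow> real" where
  "hnorm H x = sqrt (Re (iprod H x x))"

definition hdist :: "'u hilbert \<Rightarrow> 'u \<Rightarrow> 'u \<Rightarrow> real" where
  "hdist H x y = hnorm H (x \<oplus>\<^bsub>H\<^esub> (- 1) \<odot>\<^bsub>H\<^esub> y)"

text \<open>The first three assumptions force the operations to be \<^const>\<open>undefined\<close> outside the carrier,
  so that a space is determined by its carrier and the operations on it.\<close>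

locale hilbert_space =
  fixes H :: "'u hilbert" (structure)
  assumes add_type: "add H \<in> carrier H \<rightarrow>\<^sub>E carrier H \<rightarrow>\<^sub>E carrier H"
    and scale_type: "scale H \<in> UNIV \<rightarrow>\<^sub>E carrier H \<rightarrow>\<^sub>E carrier H"
    and iprod_type: "iprod H \<in> carrier H \<rightarrow>\<^sub>E carrier H \<rightarrow>\<^sub>E UNIV"
    and zero_type: "\<zero> \<in> carrier H"
    and add_assoc: "\<lbrakk>x \<in> carrier H; y \<in> carrier H; z \<in> carrier H\<rbrakk>
      \<Longrightarrow> (x \<oplus> y) \<oplus> z = x \<oplus> (y \<oplus> z)"
    and add_comm: "\<lbrakk>x \<in> carrier H; y \<in> carrier H\<rbrakk> \<Longrightarrow> x \<oplus> y = y \<oplus> x"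
    and add_zero: "x \<in> carrier H \<Longrightarrow> x \<oplus> \<zero> = x"
    and add_inverse: "x \<in> carrier H \<Longrightarrow> \<exists>y \<in> carrier H. x \<oplus> y = \<zero>"
    and scale_one: "x \<in> carrier H \<Longrightarrow> 1 \<odot> x = x"
    and scale_scale: "x \<in> carrier H \<Longrightarrow> a \<odot> b \<odot> x = (a * b) \<odot> x"
    and scale_add_left: "x \<in> carrier H \<Longrightarrow> (a + b) \<odot> x = a \<odot> x \<oplus> b \<odot> x"
    and scale_add_right: "\<lbrakk>x \<in> carrier H; y \<in> carrier H\<rbrakk>
      \<Longrightarrow> a \<odot> (x \<oplus> y) = a \<odot> x \<oplus> a \<odot> y"
    and iprod_add: "\<lbrakk>x \<in> carrier H; y \<in> carrier H; z \<in> carrier H\<rbrakk>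
      \<Longrightarrow> iprod H (x \<oplus> y) z = iprod H x z + iprod H y z"
    and iprod_scale: "\<lbrakk>x \<in> carrier H; y \<in> carrier H\<rbrakk>
      \<Longrightarrow> iprod H (a \<odot> x) y = a * iprod H x y"
    and iprod_cnj: "\<lbrakk>x \<in> carrier H; y \<in> carrier H\<rbrakk> \<Longrightarrow> iprod H y x = cnj (iprod H x y)"
    and iprod_nonneg: "x \<in> carrier H \<Longrightarrow> 0 \<le> Re (iprod H x x)"
    and iprod_definite: "x \<in> carrier H \<Longrightarrow> iprod H x x = 0 \<Longrightarrow> x = \<zero>"
    and complete: "\<lbrakk>\<forall>n. s n \<in> carrier H;
        \<forall>e>0. \<exists>N. \<forall>m\<ge>N. \<forall>n\<ge>N. hdist H (s m) (s n) < e\<rbrakk>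
      \<Longrightarrow> \<exists>x \<in> carrier H. (\<lambda>n. hdist H (s n) x) \<longlonglongrightarrow> 0"

definition linear_map :: "'u hilbert \<Rightarrow> 'u hilbert \<Rightarrow> ('u \<Rightarrow> 'u) \<Rightarrow> bool" where
  "linear_map A B f \<longleftrightarrow> f \<in> carrier A \<rightarrow> carrier B \<and>
     (\<forall>x \<in> carrier A. \<forall>y \<in> carrier A. f (x \<oplus>\<^bsub>A\<^esub> y) = f x \<oplus>\<^bsub>B\<^esub> f y) \<and>
     (\<forall>a. \<forall>x \<in> carrier A. f (a \<odot>\<^bsub>A\<^esub> x) = a \<odot>\<^bsub>B\<^esub> f x)"

definition contraction :: "'u hilbert \<Rightarrow> 'u hilbert \<Rightarrow> ('u \<Rightarrow> 'u) \<Rightarrow> bool" where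
  "contraction A B f \<longleftrightarrow> linear_map A B f \<and> (\<forall>x \<in> carrier A. hnorm B (f x) \<le> hnorm A x)"

text \<open>The category of small Hilbert spaces and injective linear contractions, with arrows encoded
  as in \<^const>\<open>Sets\<close>. A nonzero complex Hilbert space has at least continuum many elements, so a
  universe no larger than the reals contains zero spaces only.\<close>

definition Hilb_m :: "('u hilbert, 'u hilbert \<times> ('u \<Rightarrow> 'u) \<times> 'u hilbert) cat" where
  "Hilb_m = (let Hilb = {H. hilbert_space H \<and> small TYPE('u) (carrier H)} in
     \<lparr> Obj = Hilb,
       Arr = {(A, f, B). A \<in> Hilb \<and> B \<in> Hilb \<and> f \<in> extensional (carrier A) \<and>
                contraction A B f \<and> inj_on f (carrier A)},
       Dom = (\<lambda>(A, f, B). A),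
       Cod = (\<lambda>(A, f, B). B),
       Ide = (\<lambda>A. (A, \<lambda>x\<in>carrier A. x, A)),
       Cmp = (\<lambda>(B, g, E) (A, f, B'). (A, compose (carrier A) g f, E)) \<rparr>)"

lemma hom_Hilb_m:
  "f \<in> hom Hilb_m A B \<longleftrightarrow>
     (\<exists>f'. f = (A, f', B) \<and> A \<in> Obj Hilb_m \<and> B \<in> Obj Hilb_m \<and> f' \<in> extensional (carrier A) \<and>
       contraction A B f' \<and> inj_on f' (carrier A))"
  by (cases f) (auto simp: hom_def Hilb_m_def Let_def)

lemma contraction_compose:
  assumes "hilbert_space A" "contraction A B f" "contraction B E g"
  shows "contraction A E (compose (carrier A) g f)"
proof -
  interpret A: hilbert_space A by (rule assms)
  have "x \<oplus>\<^bsub>A\<^esub> y \<in> carrier A" "a \<odot>\<^bsub>A\<^esub> x \<in> carrier A" if "x \<in> carrier A" "y \<in> carrier A" for a x y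
    using A.add_type A.scale_type that by (auto simp: PiE_iff)
  then show ?thesis
    using assms(2,3) unfolding contraction_def linear_map_def
    by (auto simp: compose_def Pi_iff) (meson order_trans)
qed

lemma contraction_id: "contraction A A (\<lambda>x\<in>carrier A. x)" if "hilbert_space A"
proof -
  interpret A: hilbert_space A by (rule that)
  have "x \<oplus>\<^bsub>A\<^esub> y \<in> carrier A" "a \<odot>\<^bsub>A\<^esub> x \<in> carrier A" if "x \<in> carrier A" "y \<in> carrier A" for a x y
    using A.add_type A.scale_type that by (auto simp: PiE_iff)
  then show ?thesis
    unfolding contraction_def linear_map_def by auto
qed

lemma Obj_Hilb_m: "A \<in> Obj Hilb_m \<Longrightarrow> hilbert_space A"
  by (simp add: Hilb_m_def Let_def)

lemma Ide_Hilb_m: "Ide Hilb_m A = (A, \<lambda>x\<in>carrier A. x, A)"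
  by (simp add: Hilb_m_def Let_def)

lemma Cmp_Hilb_m: "Cmp Hilb_m (B, g, E) (A, f, B') = (A, compose (carrier A) g f, E)"
  by (simp add: Hilb_m_def Let_def)

lemma contraction_range: "contraction A B f \<Longrightarrow> x \<in> carrier A \<Longrightarrow> f x \<in> carrier B"
  by (auto simp: contraction_def linear_map_def)

lemma category_Hilb_m: "category Hilb_m"
proof (unfold_locales, goal_cases)
  case (3 A)
  then show ?case
    by (auto simp: hom_Hilb_m Ide_Hilb_m contraction_id Obj_Hilb_m inj_on_def)
next
  case (4 f A B g E)
  then obtain f' g' where fg: "f = (A, f', B)" "g = (B, g', E)"
      "contraction A B f'" "contraction B E g'" "A \<in> Obj Hilb_m" "E \<in> Obj Hilb_m"
      "inj_on f' (carrier A)" "inj_on g' (carrier B)"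
    by (auto simp: hom_Hilb_m)
  have "inj_on (compose (carrier A) g' f') (carrier A)"
    using fg(7,8) contraction_range[OF fg(3)] by (auto simp: inj_on_def compose_def)
  with fg show ?case
    by (auto simp: hom_Hilb_m Cmp_Hilb_m contraction_compose Obj_Hilb_m compose_extensional)
next
  case (5 f A B)
  then obtain f' where "f = (A, f', B)" "f' \<in> extensional (carrier A)"
    by (auto simp: hom_Hilb_m)
  then show ?case
    by (auto simp: Ide_Hilb_m Cmp_Hilb_m compose_def extensional_def)
next
  case (6 f A B)
  then obtain f' where "f = (A, f', B)" "f' \<in> extensional (carrier A)" "contraction A B f'"
    by (auto simp: hom_Hilb_m)
  then show ?case
    using contraction_range[of A B f'] by (auto simp: Ide_Hilb_m Cmp_Hilb_m compose_def extensional_def)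
next
  case (7 f A B g E h G)
  then obtain f' g' h' where "f = (A, f', B)" "g = (B, g', E)" "h = (E, h', G)"
      "contraction A B f'"
    by (auto simp: hom_Hilb_m)
  then show ?case
    using contraction_range[of A B f'] by (auto simp: Cmp_Hilb_m compose_def)
qed (auto simp: Hilb_m_def Let_def)

end

theory Submission
  imports Defs
begin

text \<open>
  \<^const>\<open>Hilb_m\<close> does not even have colimits of chains. If \<open>c\<close> is a cocone over the chain
  \<open>\<complex> \<rightarrow> \<complex> \<rightarrow> \<dots>\<close> in which every map is multiplication by \<open>1/2\<close>, then \<open>c\<^sub>0 z = c\<^sub>n (z / 2\<^sup>n)\<close> has norm at
  most \<open>\<bar>z\<bar> / 2\<^sup>n\<close> for every \<open>n\<close>, so \<open>c\<^sub>0 = 0\<close>, which is not injective.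
\<close>

text \<open>The Hilbert space of complex numbers, transported along an injection
  \<open>\<phi>\<close> because carriers in \<open>Hilb_m\<close> live inside \<open>'u\<close>. The
  restricted lambdas supply the value \<open>undefined\<close> off the carrier that
  \<open>hilbert_space\<close> demands.\<close>

definition complex_line :: "(complex \<Rightarrow> 'u) \<Rightarrow> 'u hilbert" where
  "complex_line \<phi> = \<lparr>
     carrier = range \<phi>,
     add = (\<lambda>x\<in>range \<phi>. \<lambda>y\<in>range \<phi>. \<phi> (inv \<phi> x + inv \<phi> y)),
     zero = \<phi> 0,
     scale = (\<lambda>a. \<lambda>x\<in>range \<phi>. \<phi> (a * inv \<phi> x)),
     iprod = (\<lambda>x\<in>range \<phi>. \<lambda>y\<in>range \<phi>. inv \<phi> x * cnj (inv \<phi> y)) \<rparr>"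

lemma complex_line_simps:
  assumes "inj \<phi>"
  shows "carrier (complex_line \<phi>) = range \<phi>"
    and "\<phi> a \<oplus>\<^bsub>complex_line \<phi>\<^esub> \<phi> b = \<phi> (a + b)"
    and "\<zero>\<^bsub>complex_line \<phi>\<^esub> = \<phi> 0"
    and "z \<odot>\<^bsub>complex_line \<phi>\<^esub> \<phi> a = \<phi> (z * a)"
    and "iprod (complex_line \<phi>) (\<phi> a) (\<phi> b) = a * cnj b"
  using assms by (simp_all add: complex_line_def)

lemma hnorm_complex_line: "inj \<phi> \<Longrightarrow> hnorm (complex_line \<phi>) (\<phi> a) = cmod a"
  by (simp add: hnorm_def complex_line_simps cmod_def power2_eq_square)

lemma hdist_complex_line: "inj \<phi> \<Longrightarrow> hdist (complex_line \<phi>) (\<phi> a) (\<phi> b) = dist a b"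
  by (simp add: hdist_def complex_line_simps hnorm_complex_line dist_norm)

text \<open>Each axiom pulls back along \<open>\<phi>\<close> to an identity of complex numbers.
  Completeness is inherited from the complex plane, since \<open>\<phi>\<close> is an isometry onto
  the carrier.\<close>

lemma hilbert_space_complex_line:
  assumes "inj \<phi>"
  shows "hilbert_space (complex_line \<phi>)"
proof (unfold_locales, goal_cases)
  case (8 x)
  then obtain a where "x = \<phi> a" by (auto simp: complex_line_simps[OF assms])
  then show ?case
    by (intro bexI[of _ "\<phi> (- a)"]) (auto simp: complex_line_simps[OF assms])
next
  case (18 s)
  have "\<exists>t. \<forall>n. s n = \<phi> (t n)"
    using 18(1) by (intro choice) (auto simp: complex_line_simps[OF assms])
  then obtain t where t: "s n = \<phi> (t n)" for n by blast
  have "Cauchy t"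
    using 18(2) by (simp add: t hdist_complex_line[OF assms] Cauchy_def)
  then obtain l where "t \<longlonglongrightarrow> l"
    using convergent_eq_Cauchy by blast
  then have "(\<lambda>n. dist (t n) l) \<longlonglongrightarrow> 0"
    using tendsto_dist_iff by blast
  then show ?case
    by (intro bexI[of _ "\<phi> l"])
      (simp_all add: t hdist_complex_line[OF assms] complex_line_simps[OF assms])
next
  case 1 then show ?case by (auto simp: complex_line_def)
next
  case 2 then show ?case by (auto simp: complex_line_def)
next
  case 3 then show ?case by (auto simp: complex_line_def)
qed (auto simp: complex_line_simps[OF assms] algebra_simps inj_eq[OF assms])

lemma complex_line_Obj:
  assumes "inj (\<phi> :: complex \<Rightarrow> 'u)" "small TYPE('u) (UNIV :: complex set)"
  shows "complex_line \<phi> \<in> Obj Hilb_m"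
proof -
  have "|range \<phi>| \<le>o |UNIV :: complex set|" by (rule card_of_image)
  with assms show ?thesis
    by (auto simp: Hilb_m_def Let_def small_def hilbert_space_complex_line
        complex_line_simps(1) intro: ordLeq_ordLess_trans)
qed

definition complex_mult ::
    "(complex \<Rightarrow> 'u) \<Rightarrow> complex \<Rightarrow> 'u hilbert \<times> ('u \<Rightarrow> 'u) \<times> 'u hilbert" where
  "complex_mult \<phi> z =
     (complex_line \<phi>, \<lambda>x\<in>range \<phi>. \<phi> (z * inv \<phi> x), complex_line \<phi>)"

text \<open>The condition \<open>z \<noteq> 0\<close> makes multiplication by \<open>z\<close>
  injective, and \<open>cmod z \<le> 1\<close> makes it a contraction.\<close>

lemma complex_mult_hom:
  assumes "inj (\<phi> :: complex \<Rightarrow> 'u)" "small TYPE('u) (UNIV :: complex set)" "z \<noteq> 0" "cmod z \<le> 1"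
  shows "complex_mult \<phi> z \<in> hom Hilb_m (complex_line \<phi>) (complex_line \<phi>)"
proof -
  let ?f = "\<lambda>x\<in>range \<phi>. \<phi> (z * inv \<phi> x)"
  note simps = complex_line_simps[OF assms(1)] inj_eq[OF assms(1)] inv_f_f[OF assms(1)]
  have "linear_map (complex_line \<phi>) (complex_line \<phi>) ?f"
    by (auto simp: linear_map_def simps ring_distribs mult.left_commute)
  moreover have "hnorm (complex_line \<phi>) (?f x) \<le> hnorm (complex_line \<phi>) x"
    if "x \<in> range \<phi>" for x
    using that assms(4)
    by (auto simp: simps hnorm_complex_line[OF assms(1)] norm_mult mult_left_le_one_le)
  moreover have "inj_on ?f (range \<phi>)"
    using assms(3) by (intro inj_onI) (auto simp: simps)
  ultimately show ?thesis
    using complex_line_Obj[OF assms(1,2)]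
    by (simp add: complex_mult_def hom_Hilb_m contraction_def simps(1))
qed

lemma complex_mult_one: "inj \<phi> \<Longrightarrow> complex_mult \<phi> 1 = Ide Hilb_m (complex_line \<phi>)"
  by (auto simp: complex_mult_def Ide_Hilb_m complex_line_simps intro!: restrict_ext)

lemma complex_mult_Cmp:
  "inj \<phi> \<Longrightarrow> complex_mult \<phi> z \<cdot>\<^bsub>Hilb_m\<^esub> complex_mult \<phi> w = complex_mult \<phi> (z * w)"
  by (auto simp: complex_mult_def Cmp_Hilb_m complex_line_simps compose_def mult.assoc)

text \<open>A copy of the order on the naturals, carried along \<open>\<nu>\<close> because
  \<open>has_directed_colimits\<close> ranges over index posets inside \<open>'u\<close>
  only.\<close>

definition chain_order :: "(nat \<Rightarrow> 'i) \<Rightarrow> 'i rel" where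
  "chain_order \<nu> = {(\<nu> m, \<nu> n) | m n. m \<le> n}"

lemma chain_order_iff: "inj \<nu> \<Longrightarrow> (\<nu> m, \<nu> n) \<in> chain_order \<nu> \<longleftrightarrow> m \<le> n"
  by (auto simp: chain_order_def inj_eq)

lemma directed_chain_order:
  assumes "inj \<nu>"
  shows "directed_poset natLeq (range \<nu>) (chain_order \<nu>)"
  unfolding directed_poset_def
proof (intro conjI allI impI)
  show "partial_order_on (range \<nu>) (chain_order \<nu>)"
    using assms
    by (auto simp: partial_order_on_def preorder_on_def refl_on_def trans_def antisym_def
        chain_order_def inj_eq)
next
  fix X assume X: "X \<subseteq> range \<nu>" "|X| <o natLeq"
  then obtain N where N: "X = \<nu> ` N" "finite N"
    by (metis finite_iff_ordLess_natLeq finite_subset_image)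
  \<comment> \<open>For empty \<open>N\<close> the value of \<open>Max N\<close> is unspecified, but
    its image still lies in \<open>range \<nu>\<close> and bounds the empty set vacuously.\<close>
  then show "\<exists>u\<in>range \<nu>. \<forall>x\<in>X. (x, u) \<in> chain_order \<nu>"
    by (intro bexI[of _ "\<nu> (Max N)"]) (auto simp: chain_order_iff assms)
qed

text \<open>The composite of all the halvings between two indices: \<open>inv \<nu>\<close> recovers
  their positions in the chain, and the difference counts the steps.\<close>

definition halving :: "(nat \<Rightarrow> 'i) \<Rightarrow> (complex \<Rightarrow> 'u) \<Rightarrow> 'i \<Rightarrow> 'i
    \<Rightarrow> 'u hilbert \<times> ('u \<Rightarrow> 'u) \<times> 'u hilbert" where
  "halving \<nu> \<phi> i j = complex_mult \<phi> ((1 / 2) ^ (inv \<nu> j - inv \<nu> i))"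

lemma diagram_halving:
  assumes "inj \<nu>" "inj (\<phi> :: complex \<Rightarrow> 'u)" "small TYPE('u) (UNIV :: complex set)"
  shows "diagram Hilb_m (range \<nu>) (chain_order \<nu>) (\<lambda>_. complex_line \<phi>) (halving \<nu> \<phi>)"
proof -
  \<comment> \<open>This holds even for unrelated \<open>i\<close> and \<open>j\<close>: the
    exponent is a natural number, so the factor is nonzero of modulus at most 1.\<close>
  have "halving \<nu> \<phi> i j \<in> hom Hilb_m (complex_line \<phi>) (complex_line \<phi>)" for i j
    unfolding halving_def using assms
    by (intro complex_mult_hom) (auto simp: norm_power power_le_one norm_divide)
  moreover have "halving \<nu> \<phi> j k \<cdot>\<^bsub>Hilb_m\<^esub> halving \<nu> \<phi> i j = halving \<nu> \<phi> i k"
    if ij: "(i, j) \<in> chain_order \<nu>" and jk: "(j, k) \<in> chain_order \<nu>" for i j k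
  proof -
    obtain l m where lm: "i = \<nu> l" "j = \<nu> m" "l \<le> m"
      using ij unfolding chain_order_def by blast
    moreover obtain n where "k = \<nu> n" "m \<le> n"
      using jk injD[OF assms(1)] unfolding chain_order_def lm by blast
    \<comment> \<open>The exponents \<open>n - m\<close> and \<open>m - l\<close> add up to
      \<open>n - l\<close>; with truncated subtraction this relies on \<open>l \<le> m\<close> and
      \<open>m \<le> n\<close>.\<close>
    ultimately show ?thesis
      using assms by (simp add: halving_def complex_mult_Cmp flip: power_add)
  qed
  ultimately show ?thesis
    using assms by (simp add: diagram_def complex_line_Obj halving_def complex_mult_one)
qed

text \<open>\<open>hnorm\<close> sees only the real part of \<open>iprod H x x\<close>. Conjugate
  symmetry kills the imaginary part, so that definiteness applies.\<close>

lemma (in hilbert_space) hnorm_eq_zero: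
  assumes "x \<in> carrier H" "hnorm H x \<le> 0"
  shows "x = \<zero>"
proof -
  have "Re (iprod H x x) = 0"
    using assms iprod_nonneg[OF assms(1)] by (simp add: hnorm_def)
  moreover have "Im (iprod H x x) = 0"
    using arg_cong[OF iprod_cnj[OF assms(1) assms(1)], of Im] by simp
  ultimately show ?thesis
    using iprod_definite[OF assms(1)] by (simp add: complex_eq_iff)
qed

lemma no_cocone_halving:
  assumes "inj \<nu>" "inj \<phi>"
  shows "\<not> cocone Hilb_m (range \<nu>) (chain_order \<nu>) (\<lambda>_. complex_line \<phi>) (halving \<nu> \<phi>) X c"
proof
  assume c: "cocone Hilb_m (range \<nu>) (chain_order \<nu>) (\<lambda>_. complex_line \<phi>) (halving \<nu> \<phi>) X c"
  have "\<forall>n. \<exists>f. c (\<nu> n) = (complex_line \<phi>, f, X) \<and> contraction (complex_line \<phi>) X f \<and>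
      inj_on f (range \<phi>)"
    using c assms by (auto simp: cocone_def hom_Hilb_m complex_line_simps)
  then obtain f where f: "c (\<nu> n) = (complex_line \<phi>, f n, X)"
      "contraction (complex_line \<phi>) X (f n)" "inj_on (f n) (range \<phi>)" for n
    by metis
  interpret X: hilbert_space X
    using c by (auto simp: cocone_def Obj_Hilb_m)
  have "f 0 (\<phi> z) = \<zero>\<^bsub>X\<^esub>" for z
  proof (rule X.hnorm_eq_zero)
    show "f 0 (\<phi> z) \<in> carrier X"
      using contraction_range[OF f(2)] assms by (simp add: complex_line_simps)
    have "hnorm X (f 0 (\<phi> z)) \<le> (1 / 2) ^ n * cmod z" for n
    proof -
      \<comment> \<open>The cocone equation for the pair \<open>0 \<le> n\<close> factors
        \<open>f 0\<close> through \<open>f n\<close>, after scaling by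
        \<open>(1 / 2) ^ n\<close>.\<close>
      have "c (\<nu> n) \<cdot>\<^bsub>Hilb_m\<^esub> halving \<nu> \<phi> (\<nu> 0) (\<nu> n) = c (\<nu> 0)"
        using c assms(1) by (auto simp: cocone_def chain_order_iff)
      then have "f 0 = compose (range \<phi>) (f n) (\<lambda>x\<in>range \<phi>. \<phi> ((1 / 2) ^ n * inv \<phi> x))"
        using assms by (simp add: f(1) halving_def complex_mult_def Cmp_Hilb_m complex_line_simps)
      then have "f 0 (\<phi> z) = f n (\<phi> ((1 / 2) ^ n * z))"
        using assms(2) by (simp add: compose_def)
      moreover have "hnorm X (f n (\<phi> w)) \<le> cmod w" for w
        using f(2)[of n] assms(2)
        by (auto simp: contraction_def complex_line_simps hnorm_complex_line)
      moreover have "cmod ((1 / 2) ^ n * z) = (1 / 2) ^ n * cmod z"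
        by (simp add: norm_mult norm_power norm_divide)
      ultimately show ?thesis
        by metis
    qed
    moreover have "(\<lambda>n. (1 / 2) ^ n * cmod z) \<longlonglongrightarrow> 0"
      by (intro tendsto_mult_left_zero LIMSEQ_power_zero) simp
    \<comment> \<open>A constant below every term of a sequence tending to 0 is at most 0.\<close>
    ultimately show "hnorm X (f 0 (\<phi> z)) \<le> 0"
      by (intro LIMSEQ_le_const[where X = "\<lambda>n. (1 / 2) ^ n * cmod z"]) auto
  qed
  then have "f 0 (\<phi> 0) = f 0 (\<phi> 1)"
    by simp
  then have "\<phi> 0 = \<phi> 1"
    using inj_onD[OF f(3)] by blast
  with assms(2) show False
    by (simp add: inj_eq)
qed

text \<open>Complex numbers are pairs of reals, and an infinite set is equinumerous with its square.
  This turns the cardinality hypothesis on the reals into smallness of the carrier of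
  \<open>complex_line\<close>.\<close>

lemma card_of_complex: "|UNIV :: complex set| =o |UNIV :: real set|"
proof -
  have "bij_betw (\<lambda>z. (Re z, Im z)) UNIV (UNIV \<times> UNIV)"
    by (rule bij_betwI[where g = "\<lambda>(a, b). Complex a b"]) auto
  then have "|UNIV :: complex set| =o |(UNIV :: real set) \<times> (UNIV :: real set)|"
    using card_of_ordIso by blast
  also have "|(UNIV :: real set) \<times> (UNIV :: real set)| =o |UNIV :: real set|"
    by (rule card_of_Times_same_infinite) (simp add: infinite_UNIV_char_0)
  finally show ?thesis .
qed

theorem corollary19:
  assumes "|UNIV :: real set| <o |UNIV :: 'u set|"
  shows "\<not> abstract_elementary_category TYPE('u) TYPE('p) TYPE('n)
           (Hilb_m :: ('u hilbert, 'u hilbert \<times> ('u \<Rightarrow> 'u) \<times> 'u hilbert) cat)"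
proof
  assume "abstract_elementary_category TYPE('u) TYPE('p) TYPE('n)
           (Hilb_m :: ('u hilbert, 'u hilbert \<times> ('u \<Rightarrow> 'u) \<times> 'u hilbert) cat)"
  \<comment> \<open>This clause does not mention the ambient category, so refuting it settles all
    \<open>'p\<close> and \<open>'n\<close> at once.\<close>
  then have colim: "has_directed_colimits TYPE('u) natLeq
           (Hilb_m :: ('u hilbert, 'u hilbert \<times> ('u \<Rightarrow> 'u) \<times> 'u hilbert) cat)"
    by (simp add: abstract_elementary_category_def)
  have sm: "small TYPE('u) (UNIV :: complex set)"
    unfolding small_def by (rule ordIso_ordLess_trans[OF card_of_complex assms])
  then obtain \<phi> :: "complex \<Rightarrow> 'u" where \<phi>: "inj \<phi>"
    unfolding small_def by (meson card_of_ordLeq ordLess_imp_ordLeq subset_UNIV)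
  \<comment> \<open>The copy of the naturals inside that of the complex numbers serves as index set,
    so its smallness follows from \<open>sm\<close>.\<close>
  define \<nu> where "\<nu> n = \<phi> (of_nat n)" for n
  have \<nu>: "inj \<nu>"
    using \<phi> by (intro injI) (simp add: \<nu>_def inj_eq)
  have "|range \<nu>| \<le>o |range \<phi>|"
    by (rule card_of_mono1) (auto simp: \<nu>_def)
  also have "|range \<phi>| \<le>o |UNIV :: complex set|"
    by (rule card_of_image)
  finally have "small TYPE('u) (range \<nu>)"
    using sm unfolding small_def by (rule ordLeq_ordLess_trans)
  then obtain X c where
      "colimit Hilb_m (range \<nu>) (chain_order \<nu>) (\<lambda>_. complex_line \<phi>) (halving \<nu> \<phi>) X c"
    using colim directed_chain_order[OF \<nu>] diagram_halving[OF \<nu> \<phi> sm]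
    unfolding has_directed_colimits_def by blast
  then show False
    using no_cocone_halving[OF \<nu> \<phi>] by (simp add: colimit_def)
qed

end
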